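(* Let $G$ be a discrete group, let $(X,G)$ be a tame $G$-flow, let $\mathcal M$ be a minimal left ideal of $E:=E(X,G)$, let $u\in\mathcal M$ be an idempotent, put $K:=u\mathcal M$ and let $j:K\to E$ be the inclusion. Let $\mathfrak h_K$ be the normalized Haar measure on the compact Hausdorff topological group $(K,\tau)$. If $F\in C(E,\mathbb C)$, then $F\circ j:K\to\mathbb C$ is $\mathfrak h_K$-measurable, i.e. measurable for the $\mathfrak h_K$-completion of the Borel $\sigma$-algebra of $(K,\tau)$.
   Context: All compact spaces are Hausdorff. A $G$-flow $(X,G)$ is a compact space $X$ with an action of the discrete group $G$ by homeomorphisms. The enveloping semigroup $E=E(X,G)$ is the closure of $\{g_X:g\in G\}$ in $X^X$ with the product topology, where $g_X(x)=gx$; it is a semigroup under composition. A map $f:X\to Y$ from a compact space to a uniform space is fragmented if for every nonempty $A\subseteq X$ and every entourage $V$ of $Y$ there is a nonempty relatively open $U\subseteq A$ with $(f(x),f(y))\in V$ for all $x,y\in U$. The flow $(X,G)$ is tame if every element of $E$ is a fragmented map $X\to X$ (with $X$ carrying its unique compatible uniformity). For a minimal left ideal $\mathcal M$ of $E$ and an idempotent $u\in\mathcal M$, the set $K=u\mathcal M$ is a group (an Ellis group). For $p\in E$, $A\subseteq E$ let $p\circ A$ be the set of $q\in E$ for which there are nets $(g_i)$ in $G$ and $(a_i)$ in $A$ with $g_i\to p$ and $g_ia_i\to q$. The $\tau$-topology on $K$ is the topology with closure operator $\operatorname{cl}_\tau(A)=K\cap(u\circ A)$. When $(X,G)$ is tame,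 $(K,\tau)$ is a compact Hausdorff topological group. *)

theory Defs
  imports "HOL-Analysis.Analysis" "HOL-Algebra.Group_Action"
begin

section \<open>Flows and their enveloping semigroups\<close>

text \<open>
  The phase space is the whole type \<open>'x\<close>. Function spaces \<open>'x \<Rightarrow> 'x\<close> carry
  the product topology (instance of \<open>fun\<close> in \<^theory>\<open>HOL-Analysis.Function_Topology\<close>),
  and the semigroup operation is composition.
\<close>

definition compact_flow :: "('g, 'b) monoid_scheme \<Rightarrow> ('g \<Rightarrow> 'x::t2_space \<Rightarrow> 'x) \<Rightarrow> bool" where
  "compact_flow G \<phi> \<longleftrightarrow>
     compact (UNIV :: 'x set) \<and>
     group_action G UNIV \<phi> \<and>
     (\<forall>g\<in>carrier G. homeomorphic_map euclidean euclidean (\<phi> g))"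

definition enveloping_semigroup ::
    "('g, 'b) monoid_scheme \<Rightarrow> ('g \<Rightarrow> 'x::topological_space \<Rightarrow> 'x) \<Rightarrow> ('x \<Rightarrow> 'x) set" where
  "enveloping_semigroup G \<phi> = closure (\<phi> ` carrier G)"

definition fragmented :: "('a::topological_space \<Rightarrow> 'b::uniform_space) \<Rightarrow> bool" where
  "fragmented f \<longleftrightarrow>
     (\<forall>A V. A \<noteq> {} \<and> (\<forall>\<^sub>F z in uniformity. z \<in> V) \<longrightarrow>
        (\<exists>U. U \<noteq> {} \<and> openin (top_of_set A) U \<and> (\<forall>x\<in>U. \<forall>y\<in>U. (f x, f y) \<in> V)))"

text \<open>
  The uniformity of a \<^class>\<open>uniform_space\<close> induces its topology; on a compact
  Hausdorff space it is therefore the unique compatible one.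
\<close>

definition tame_flow ::
    "('g, 'b) monoid_scheme \<Rightarrow> ('g \<Rightarrow> 'x::{t2_space, uniform_space} \<Rightarrow> 'x) \<Rightarrow> bool" where
  "tame_flow G \<phi> \<longleftrightarrow>
     compact_flow G \<phi> \<and> (\<forall>p\<in>enveloping_semigroup G \<phi>. fragmented p)"


section \<open>Minimal left ideals and Ellis groups\<close>

definition left_ideal :: "('x \<Rightarrow> 'x) set \<Rightarrow> ('x \<Rightarrow> 'x) set \<Rightarrow> bool" where
  "left_ideal E L \<longleftrightarrow> L \<noteq> {} \<and> L \<subseteq> E \<and> (\<forall>p\<in>E. \<forall>q\<in>L. p \<circ> q \<in> L)"

definition minimal_left_ideal :: "('x \<Rightarrow> 'x) set \<Rightarrow> ('x \<Rightarrow> 'x) set \<Rightarrow> bool" where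
  "minimal_left_ideal E M \<longleftrightarrow>
     left_ideal E M \<and> (\<forall>L. left_ideal E L \<and> L \<subseteq> M \<longrightarrow> L = M)"

definition ellis_group :: "('x \<Rightarrow> 'x) \<Rightarrow> ('x \<Rightarrow> 'x) set \<Rightarrow> ('x \<Rightarrow> 'x) set" where
  "ellis_group u M = (\<lambda>p. u \<circ> p) ` M"


section \<open>The tau-topology\<close>

text \<open>
  A pair of nets \<open>(g\<^sub>i)\<close>, \<open>(a\<^sub>i)\<close> over a common directed set is represented by the
  proper filter on \<open>G \<times> A\<close> that its tails generate; conversely, every proper
  filter arises in this way.
\<close>

definition circ ::
    "('g, 'b) monoid_scheme \<Rightarrow> ('g \<Rightarrow> 'x::topological_space \<Rightarrow> 'x) \<Rightarrow>
     ('x \<Rightarrow> 'x) \<Rightarrow> ('x \<Rightarrow> 'x) set \<Rightarrow> ('x \<Rightarrow> 'x) set" where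
  "circ G \<phi> p A =
     {q \<in> enveloping_semigroup G \<phi>.
        \<exists>\<F> :: ('g \<times> ('x \<Rightarrow> 'x)) filter.
          \<F> \<noteq> bot \<and> (\<forall>\<^sub>F (g, a) in \<F>. g \<in> carrier G \<and> a \<in> A) \<and>
          ((\<lambda>(g, a). \<phi> g) \<longlongrightarrow> p) \<F> \<and> ((\<lambda>(g, a). \<phi> g \<circ> a) \<longlongrightarrow> q) \<F>}"

definition cl_tau ::
    "('g, 'b) monoid_scheme \<Rightarrow> ('g \<Rightarrow> 'x::topological_space \<Rightarrow> 'x) \<Rightarrow>
     ('x \<Rightarrow> 'x) \<Rightarrow> ('x \<Rightarrow> 'x) set \<Rightarrow> ('x \<Rightarrow> 'x) set \<Rightarrow> ('x \<Rightarrow> 'x) set" where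
  "cl_tau G \<phi> u M A = ellis_group u M \<inter> circ G \<phi> u A"

definition tau_topology ::
    "('g, 'b) monoid_scheme \<Rightarrow> ('g \<Rightarrow> 'x::topological_space \<Rightarrow> 'x) \<Rightarrow>
     ('x \<Rightarrow> 'x) \<Rightarrow> ('x \<Rightarrow> 'x) set \<Rightarrow> ('x \<Rightarrow> 'x) topology" where
  "tau_topology G \<phi> u M =
     topology (\<lambda>U. U \<subseteq> ellis_group u M \<and>
       cl_tau G \<phi> u M (ellis_group u M - U) = ellis_group u M - U)"

text \<open>
  The remainder of this section shows that this is indeed a topology on the Ellis
  group, with closure operator \<^const>\<open>cl_tau\<close>.
\<close>

lemma circ_iff_closure:
  fixes \<phi> :: "'g \<Rightarrow> 'x::topological_space \<Rightarrow> 'x"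
  shows "q \<in> circ G \<phi> p A \<longleftrightarrow> q \<in> enveloping_semigroup G \<phi> \<and>
    (p, q) \<in> closure ((\<lambda>(g, a). (\<phi> g, \<phi> g \<circ> a)) ` (carrier G \<times> A))"
    (is "_ \<longleftrightarrow> _ \<and> _ \<in> closure (?h ` ?S)")
proof -
  have *: "(\<exists>\<F>. \<F> \<noteq> bot \<and> (\<forall>\<^sub>F (g, a) in \<F>. g \<in> carrier G \<and> a \<in> A) \<and>
          ((\<lambda>(g, a). \<phi> g) \<longlongrightarrow> p) \<F> \<and> ((\<lambda>(g, a). \<phi> g \<circ> a) \<longlongrightarrow> q) \<F>)
     \<longleftrightarrow> (p, q) \<in> closure (?h ` ?S)" (is "?l \<longleftrightarrow> ?r")
  proof
    assume ?l
    then obtain F where F: "F \<noteq> bot" "\<forall>\<^sub>F (g, a) in F. g \<in> carrier G \<and> a \<in> A"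
      "((\<lambda>(g, a). \<phi> g) \<longlongrightarrow> p) F" "((\<lambda>(g, a). \<phi> g \<circ> a) \<longlongrightarrow> q) F" by blast
    have lim: "(?h \<longlongrightarrow> (p, q)) F"
      using tendsto_Pair[OF F(3,4)] by (simp add: case_prod_unfold)
    have "\<forall>\<^sub>F z in F. ?h z \<in> closure (?h ` ?S)"
      using F(2) by (rule eventually_mono) (use closure_subset in fastforce)
    then show ?r
      using Lim_in_closed_set[OF closed_closure _ F(1) lim] by blast
  next
    assume r: ?r
    define F where "F = inf (filtercomap ?h (nhds (p, q))) (principal ?S)"
    have "F \<noteq> bot"
    proof
      assume "F = bot"
      then have "eventually (\<lambda>z. z \<notin> ?S) (filtercomap ?h (nhds (p, q)))"
        using eventually_inf_principal[of "\<lambda>_. False" "filtercomap ?h (nhds (p, q))" ?S]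
        unfolding F_def trivial_limit_def[symmetric] by (simp add: trivial_limit_def)
      then obtain P where P: "eventually P (nhds (p, q))" "\<And>z. P (?h z) \<Longrightarrow> z \<notin> ?S"
        unfolding eventually_filtercomap by blast
      then obtain W where W: "open W" "(p, q) \<in> W" "\<And>y. y \<in> W \<Longrightarrow> P y"
        unfolding eventually_nhds by blast
      then have "W \<inter> ?h ` ?S \<noteq> {}"
        using r open_Int_closure_eq_empty[of W "?h ` ?S"] by blast
      then show False using W(3) P(2) by blast
    qed
    moreover have "\<forall>\<^sub>F (g, a) in F. g \<in> carrier G \<and> a \<in> A"
      unfolding F_def eventually_inf_principal by (rule always_eventually) auto
    moreover have lim: "(?h \<longlongrightarrow> (p, q)) F"
      unfolding F_def by (meson filterlim_filtercomap filterlim_mono inf_le1 order_refl)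
    have "((\<lambda>(g, a). \<phi> g) \<longlongrightarrow> p) F" "((\<lambda>(g, a). \<phi> g \<circ> a) \<longlongrightarrow> q) F"
      using tendsto_fst[OF lim] tendsto_snd[OF lim] by (simp_all add: case_prod_unfold)
    ultimately show ?l by blast
  qed
  show ?thesis unfolding circ_def using * by simp
qed

lemma continuous_comp_right:
  "continuous_on UNIV (\<lambda>p :: 'x::topological_space \<Rightarrow> 'x. p \<circ> q)"
  by (rule continuous_on_coordinatewise_then_product) (auto intro: continuous_on_product_coordinates)

lemma continuous_comp_left:
  assumes "continuous_on UNIV (f :: 'x::topological_space \<Rightarrow> 'x)"
  shows "continuous_on UNIV (\<lambda>p :: 'x \<Rightarrow> 'x. f \<circ> p)"
  by (rule continuous_on_coordinatewise_then_product)
    (auto intro: continuous_on_compose2[OF assms] continuous_on_product_coordinates)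

lemma continuous_mem_closure:
  assumes "continuous_on UNIV f" "f ` S \<subseteq> closure T" "x \<in> closure S"
  shows "f x \<in> closure T"
  using image_closure_subset[OF continuous_on_subset[OF assms(1) subset_UNIV] closed_closure assms(2)]
    assms(3) by blast

lemma circ_Un: "circ G \<phi> p (A \<union> B) = circ G \<phi> p A \<union> circ G \<phi> p B"
  by (auto simp: circ_iff_closure Sigma_Un_distrib2 image_Un closure_Un)

lemma circ_empty: "circ G \<phi> p {} = {}"
  by (auto simp: circ_iff_closure)

lemma circ_mono: "A \<subseteq> B \<Longrightarrow> circ G \<phi> p A \<subseteq> circ G \<phi> p B"
  by (metis circ_Un sup.absorb_iff2)

context
  fixes G :: "('g, 'b) monoid_scheme" and \<phi> :: "'g \<Rightarrow> 'x::t2_space \<Rightarrow> 'x" and u M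
  assumes flow: "compact_flow G \<phi>"
    and min: "minimal_left_ideal (enveloping_semigroup G \<phi>) M"
    and u: "u \<in> M" "u \<circ> u = u"
begin

private lemma K_sub: "ellis_group u M \<subseteq> enveloping_semigroup G \<phi>"
  using min u unfolding ellis_group_def minimal_left_ideal_def left_ideal_def by blast

private lemma act_mult:
  assumes "g \<in> carrier G" "h \<in> carrier G"
  shows "\<phi> (g \<otimes>\<^bsub>G\<^esub> h) = \<phi> g \<circ> \<phi> h" "g \<otimes>\<^bsub>G\<^esub> h \<in> carrier G"
proof -
  interpret group_action G UNIV \<phi> using flow by (simp add: compact_flow_def)
  interpret group_hom G "BijGroup UNIV" \<phi> by (rule group_hom)
  show "g \<otimes>\<^bsub>G\<^esub> h \<in> carrier G" using assms by simp
  have "\<phi> g \<in> Bij UNIV" "\<phi> h \<in> Bij UNIV"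
    using assms hom_closed unfolding BijGroup_def by auto
  then show "\<phi> (g \<otimes>\<^bsub>G\<^esub> h) = \<phi> g \<circ> \<phi> h"
    using hom_mult[OF assms] by (auto simp: BijGroup_def compose_def)
qed

private lemma act_continuous: "g \<in> carrier G \<Longrightarrow> continuous_on UNIV (\<phi> g)"
  using flow unfolding compact_flow_def
  by (auto dest!: homeomorphic_imp_continuous_map simp flip: continuous_map_iff_continuous2)

lemma cl_tau_extensive:
  assumes "A \<subseteq> ellis_group u M"
  shows "A \<subseteq> cl_tau G \<phi> u M A"
proof
  fix a assume a: "a \<in> A"
  have ua: "u \<circ> a = a"
    using a assms u(2) unfolding ellis_group_def by (auto simp flip: comp_assoc)
  let ?f = "\<lambda>p :: 'x \<Rightarrow> 'x. (p, p \<circ> a)"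
  have cont: "continuous_on UNIV ?f"
    by (intro continuous_on_Pair continuous_on_id continuous_comp_right)
  have "u \<in> closure (\<phi> ` carrier G)"
    using u min unfolding minimal_left_ideal_def left_ideal_def enveloping_semigroup_def by blast
  then have "?f u \<in> closure (?f ` \<phi> ` carrier G)"
    by (rule continuous_mem_closure[OF cont closure_subset])
  also have "\<dots> \<subseteq> closure ((\<lambda>(g, a). (\<phi> g, \<phi> g \<circ> a)) ` (carrier G \<times> A))"
    by (rule closure_mono) (use a in auto)
  finally show "a \<in> cl_tau G \<phi> u M A"
    using a assms K_sub ua by (auto simp: cl_tau_def circ_iff_closure)
qed

lemma cl_tau_idem: "cl_tau G \<phi> u M (cl_tau G \<phi> u M A) \<subseteq> cl_tau G \<phi> u M A"
proof
  fix q assume q: "q \<in> cl_tau G \<phi> u M (cl_tau G \<phi> u M A)"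
  let ?h = "\<lambda>(g, a). (\<phi> g, \<phi> g \<circ> a)"
  define C where "C = closure (?h ` (carrier G \<times> A))"
  have step: "(\<phi> g \<circ> u, \<phi> g \<circ> b) \<in> C" if g: "g \<in> carrier G" and b: "b \<in> circ G \<phi> u A" for g b
  proof -
    let ?f = "\<lambda>z :: ('x \<Rightarrow> 'x) \<times> ('x \<Rightarrow> 'x). (\<phi> g \<circ> fst z, \<phi> g \<circ> snd z)"
    have cont: "continuous_on UNIV ?f"
      by (intro continuous_on_Pair continuous_on_compose2[OF continuous_comp_left[OF act_continuous[OF g]]]
          continuous_on_fst continuous_on_snd continuous_on_id) auto
    have "?f ` ?h ` (carrier G \<times> A) \<subseteq> ?h ` (carrier G \<times> A)"
    proof clarsimp
      fix k a assume "k \<in> carrier G" "a \<in> A"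
      then show "(\<phi> g \<circ> \<phi> k, \<phi> g \<circ> (\<phi> k \<circ> a)) \<in> ?h ` (carrier G \<times> A)"
        using act_mult[OF g] by (intro image_eqI[where x = "(g \<otimes>\<^bsub>G\<^esub> k, a)"]) (auto simp: comp_assoc)
    qed
    then have "?f ` ?h ` (carrier G \<times> A) \<subseteq> C"
      unfolding C_def by (rule order_trans[OF _ closure_subset])
    moreover have "(u, b) \<in> closure (?h ` (carrier G \<times> A))"
      using b by (simp add: circ_iff_closure)
    ultimately have "?f (u, b) \<in> C"
      unfolding C_def by (rule continuous_mem_closure[OF cont])
    then show ?thesis by simp
  qed
  let ?r = "\<lambda>z :: ('x \<Rightarrow> 'x) \<times> ('x \<Rightarrow> 'x). (fst z \<circ> u, snd z)"
  have contr: "continuous_on UNIV ?r"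
    by (intro continuous_on_Pair continuous_on_compose2[OF continuous_comp_right]
        continuous_on_fst continuous_on_snd continuous_on_id) auto
  have "?r ` ?h ` (carrier G \<times> cl_tau G \<phi> u M A) \<subseteq> C"
    using step unfolding cl_tau_def by auto
  moreover have "q \<in> circ G \<phi> u (cl_tau G \<phi> u M A)"
    using q cl_tau_def by blast
  then have "(u, q) \<in> closure (?h ` (carrier G \<times> cl_tau G \<phi> u M A))"
    by (simp add: circ_iff_closure)
  ultimately have "?r (u, q) \<in> C"
    unfolding C_def by (rule continuous_mem_closure[OF contr])
  then have "(u, q) \<in> C" using u(2) by simp
  then show "q \<in> cl_tau G \<phi> u M A"
    using q by (simp add: cl_tau_def circ_iff_closure C_def)
qed

lemma cl_tau_Un: "cl_tau G \<phi> u M (A \<union> B) = cl_tau G \<phi> u M A \<union> cl_tau G \<phi> u M B"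
  unfolding cl_tau_def circ_Un by blast

lemma cl_tau_mono: "A \<subseteq> B \<Longrightarrow> cl_tau G \<phi> u M A \<subseteq> cl_tau G \<phi> u M B"
  unfolding cl_tau_def using circ_mono by blast

lemma openin_tau_topology:
  "openin (tau_topology G \<phi> u M) U \<longleftrightarrow> U \<subseteq> ellis_group u M \<and>
     cl_tau G \<phi> u M (ellis_group u M - U) = ellis_group u M - U"
proof -
  let ?K = "ellis_group u M"
  let ?c = "cl_tau G \<phi> u M"
  have "istopology (\<lambda>U. U \<subseteq> ?K \<and> ?c (?K - U) = ?K - U)"
    unfolding istopology_def
  proof (intro conjI allI impI)
    fix S T assume *: "S \<subseteq> ?K \<and> ?c (?K - S) = ?K - S" "T \<subseteq> ?K \<and> ?c (?K - T) = ?K - T"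
    then show "?c (?K - S \<inter> T) = ?K - S \<inter> T"
      using cl_tau_Un[of "?K - S" "?K - T"] by (simp add: Diff_Int)
    show "S \<inter> T \<subseteq> ?K" using * by blast
  next
    fix \<U> assume *: "\<forall>S\<in>\<U>. S \<subseteq> ?K \<and> ?c (?K - S) = ?K - S"
    then show "\<Union> \<U> \<subseteq> ?K" by blast
    have "?c (?K - \<Union> \<U>) \<subseteq> ?K - S" if "S \<in> \<U>" for S
      using * that cl_tau_mono[of "?K - \<Union> \<U>" "?K - S"] by blast
    moreover have "?c (?K - \<Union> \<U>) \<subseteq> ?K" unfolding cl_tau_def by blast
    ultimately show "?c (?K - \<Union> \<U>) = ?K - \<Union> \<U>"
      using cl_tau_extensive[of "?K - \<Union> \<U>"] by blast
  qed
  then show ?thesis unfolding tau_topology_def by simp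
qed

lemma topspace_tau_topology: "topspace (tau_topology G \<phi> u M) = ellis_group u M"
proof -
  have "openin (tau_topology G \<phi> u M) (ellis_group u M)"
    unfolding openin_tau_topology by (simp add: cl_tau_def circ_empty)
  moreover have "topspace (tau_topology G \<phi> u M) \<subseteq> ellis_group u M"
    using openin_topspace[of "tau_topology G \<phi> u M"] unfolding openin_tau_topology by blast
  ultimately show ?thesis using openin_subset by blast
qed

lemma closure_of_tau_topology:
  assumes "A \<subseteq> ellis_group u M"
  shows "tau_topology G \<phi> u M closure_of A = cl_tau G \<phi> u M A"
proof (rule closure_of_unique)
  have closed: "closedin (tau_topology G \<phi> u M) C \<longleftrightarrow>
      C \<subseteq> ellis_group u M \<and> cl_tau G \<phi> u M C = C" for C
    unfolding closedin_def topspace_tau_topology openin_tau_topology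
    by (auto simp: double_diff)
  show "A \<subseteq> cl_tau G \<phi> u M A" by (rule cl_tau_extensive[OF assms])
  have sub: "cl_tau G \<phi> u M A \<subseteq> ellis_group u M" unfolding cl_tau_def by blast
  show "closedin (tau_topology G \<phi> u M) (cl_tau G \<phi> u M A)"
    unfolding closed using cl_tau_idem cl_tau_extensive[OF sub] sub by blast
  show "cl_tau G \<phi> u M A \<subseteq> T" if "A \<subseteq> T" "closedin (tau_topology G \<phi> u M) T" for T
    using that cl_tau_mono[of A T] unfolding closed by blast
qed

end


section \<open>Haar measure\<close>

text \<open>
  Normalized Haar measure on a compact Hausdorff topological group whose space is
  \<open>topspace T\<close> and whose multiplication is \<open>mul\<close>: the regular, left-invariant Borel
  probability measure.
\<close>

definition normalized_haar_measure ::
    "'a topology \<Rightarrow> ('a \<Rightarrow> 'a \<Rightarrow> 'a) \<Rightarrow> 'a measure \<Rightarrow> bool" where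
  "normalized_haar_measure T mul \<mu> \<longleftrightarrow>
     space \<mu> = topspace T \<and>
     sets \<mu> = sigma_sets (topspace T) {U. openin T U} \<and>
     emeasure \<mu> (topspace T) = 1 \<and>
     (\<forall>k\<in>topspace T. \<forall>A\<in>sets \<mu>. emeasure \<mu> (mul k ` A) = emeasure \<mu> A) \<and>
     (\<forall>A\<in>sets \<mu>. emeasure \<mu> A = (INF U\<in>{U. openin T U \<and> A \<subseteq> U}. emeasure \<mu> U)) \<and>
     (\<forall>U. openin T U \<longrightarrow>
        emeasure \<mu> U = (SUP C\<in>{C. compactin T C \<and> C \<subseteq> U}. emeasure \<mu> C))"

end

theory Submission
  imports Defs
begin

text \<open>
  The continuous functions \<open>p \<mapsto> f (p y)\<close>, with \<open>y\<close> a point of the phase space and \<open>f\<close> a continuous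
  real function on it, separate the points of the enveloping semigroup. By Stone-Weierstrass
  (\<open>measurable_by_coordinates\<close>) it suffices to treat the map \<open>h k = f (k y)\<close> on the Ellis group.

  The crucial fact is that \<open>h\<close> is fragmented for the \<open>\<tau>\<close>-topology, in the following form: if \<open>A\<close> is
  a nonempty \<open>\<tau>\<close>-closed set and \<open>c < d\<close>, then \<open>{k \<in> A. h k < c}\<close> and \<open>{k \<in> A. d < h k}\<close> are not both
  \<open>\<tau>\<close>-dense in \<open>A\<close> (\<open>tame_not_doubly_tau_dense\<close>). Suppose that they are. Since \<open>\<tau>\<close>-density means that
  points of \<open>A\<close> are approached by products of group elements near \<open>u\<close> with elements of the dense
  set, and since \<open>u\<close> fixes the Ellis group, one can approach finitely many points at once with a
  single group element (\<open>simultaneous_circ_approximation\<close>). Iterating this along the binary tree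
  produces group elements whose action on the phase space is independent: the sets
  \<open>{f \<le> c}\<close> and \<open>{f \<ge> d}\<close> can be visited in any prescribed pattern. A cluster point of an
  independent sequence of continuous maps is never fragmented
  (\<open>independent_sequence_has_nonfragmented_cluster_point\<close>), and this contradicts tameness.

  It follows that some \<open>\<tau>\<close>-open set meeting \<open>A\<close> keeps \<open>h\<close> below \<open>b\<close> or above \<open>a\<close> on \<open>A\<close>, for any
  \<open>a < b\<close>. Measurability then follows by an exhaustion argument
  (\<open>level_separated_imp_completion_measurable\<close>): peeling off such open sets uses up the whole
  group, and inner regularity of the Haar measure reduces the peeling to countably many steps up
  to a null set.
\<close>

section \<open>Function spaces with the product topology\<close>

lemma compact_UNIV_fun:
  assumes "compact (UNIV :: 'b::topological_space set)"
  shows "compact (UNIV :: ('a \<Rightarrow> 'b) set)"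
proof -
  have "compact_space (euclidean :: 'b topology)"
    using assms by (simp add: compact_space_def)
  then have "compact_space (product_topology (\<lambda>_::'a. euclidean :: 'b topology) UNIV)"
    by (simp add: compact_space_product_topology)
  then show ?thesis
    unfolding euclidean_product_topology by (simp add: compact_space_def)
qed

lemma open_coordinate_preimage:
  assumes "open W"
  shows "open {r :: 'a \<Rightarrow> 'b::topological_space. r x \<in> W}"
proof -
  have "continuous_on UNIV (\<lambda>r :: 'a \<Rightarrow> 'b. r x)"
    by (rule continuous_on_product_coordinates)
  from open_vimage[OF assms this] show ?thesis by (simp add: vimage_def)
qed

text \<open>
  The Stone-Weierstrass theorem, which reduces the theorem to coordinate functions, is stated
  for sets in a \<^class>\<open>t2_space\<close>. The arity of a type constructor for a class may not be more
  general than its arity for a superclass, so the two weaker separation axioms come first.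
\<close>

instance "fun" :: (type, t0_space) t0_space
proof
  fix p q :: "'a \<Rightarrow> 'b"
  assume "p \<noteq> q"
  then obtain x where ne: "p x \<noteq> q x" by auto
  then obtain U where "open U" "\<not> (p x \<in> U \<longleftrightarrow> q x \<in> U)"
    using ne separation_t0 by blast
  with open_coordinate_preimage[of U x]
  show "\<exists>U. open U \<and> \<not> (p \<in> U \<longleftrightarrow> q \<in> U)"
    by (intro exI[of _ "{r. r x \<in> U}"]) simp
qed

instance "fun" :: (type, t1_space) t1_space
proof
  fix p q :: "'a \<Rightarrow> 'b"
  assume "p \<noteq> q"
  then obtain x where ne: "p x \<noteq> q x" by auto
  then obtain U where "open U" "p x \<in> U" "q x \<notin> U"
    using t1_space[OF ne] by blast
  with open_coordinate_preimage[of U x]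
  show "\<exists>U. open U \<and> p \<in> U \<and> q \<notin> U"
    by (intro exI[of _ "{r. r x \<in> U}"]) simp
qed

instance "fun" :: (type, t2_space) t2_space
proof
  fix p q :: "'a \<Rightarrow> 'b"
  assume "p \<noteq> q"
  then obtain x where ne: "p x \<noteq> q x" by auto
  then obtain U V where UV: "open U" "open V" "p x \<in> U" "q x \<in> V" "U \<inter> V = {}"
    using hausdorff[OF ne] by blast
  with open_coordinate_preimage[of U x] open_coordinate_preimage[of V x]
  show "\<exists>U V. open U \<and> open V \<and> p \<in> U \<and> q \<in> V \<and> U \<inter> V = {}"
    by (intro exI[of _ "{r. r x \<in> U}"] exI[of _ "{r. r x \<in> V}"]) auto
qed

lemma compact_Hausdorff_separating_function:
  fixes x y :: "'x::t2_space"
  assumes "compact (UNIV :: 'x set)" "x \<noteq> y"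
  obtains f :: "'x \<Rightarrow> real" where "continuous_on UNIV f" "f x \<noteq> f y"
proof -
  have "Hausdorff_space (euclidean :: 'x topology)"
    unfolding Hausdorff_space_def disjnt_def using hausdorff[where 'a = 'x] by simp
  then have "normal_space (euclidean :: 'x topology)"
    using assms(1) by (intro compact_Hausdorff_or_regular_imp_normal_space)
      (auto simp: compact_space_def)
  then obtain f where "continuous_map (euclidean :: 'x topology) euclideanreal f"
    "f ` {x} \<subseteq> {0}" "f ` {y} \<subseteq> {1}"
    using assms(2) by (elim Urysohn_lemma_alt[of _ "{x}" "{y}" 0 1]) auto
  then show thesis by (intro that[of f]) auto
qed


section \<open>Independent sequences and fragmented maps\<close>

text \<open>
  A map that is fragmented with respect to this entourage cannot take values in both sets
  on the small piece. The entourage is the usual Lebesgue-number one: each point of \<open>P\<close> has an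
  entourage that keeps it away from \<open>Q\<close> even after two steps, and finitely many first steps cover
  \<open>P\<close>.
\<close>

lemma disjoint_closed_sets_entourage:
  fixes P Q :: "'b::uniform_space set"
  assumes "compact P" "closed Q" "P \<inter> Q = {}"
  shows "\<forall>\<^sub>F z in uniformity. z \<notin> P \<times> Q"
proof -
  have "\<exists>D. eventually D uniformity \<and> (\<forall>x y. D (p, x) \<longrightarrow> D (x, y) \<longrightarrow> y \<notin> Q)"
    if "p \<in> P" for p
  proof -
    have "eventually (\<lambda>(x', y). x' = p \<longrightarrow> y \<in> - Q) uniformity"
      using assms that open_uniformity[of "- Q"] by auto
    then show ?thesis by (rule uniformity_transE) (auto intro!: exI)
  qed
  then obtain D where D: "\<And>p. p \<in> P \<Longrightarrow> eventually (D p) uniformity"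
    "\<And>p x y. p \<in> P \<Longrightarrow> D p (p, x) \<Longrightarrow> D p (x, y) \<Longrightarrow> y \<notin> Q"
    by metis
  have "\<exists>N. open N \<and> p \<in> N \<and> (\<forall>x\<in>N. D p (p, x))" if "p \<in> P" for p
  proof -
    have "eventually (\<lambda>x. D p (p, x)) (nhds p)"
      unfolding eventually_nhds_uniformity using D(1)[OF that] by (rule eventually_mono) auto
    then show ?thesis unfolding eventually_nhds by blast
  qed
  then obtain N where N: "\<And>p. p \<in> P \<Longrightarrow> open (N p)" "\<And>p. p \<in> P \<Longrightarrow> p \<in> N p"
    "\<And>p x. p \<in> P \<Longrightarrow> x \<in> N p \<Longrightarrow> D p (p, x)"
    by metis
  obtain S where S: "S \<subseteq> P" "finite S" "P \<subseteq> (\<Union>p\<in>S. N p)"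
    using compactE_image[OF assms(1), of P N] N by blast
  have "eventually (\<lambda>z. \<forall>p\<in>S. D p z) uniformity"
    using S D(1) by (auto simp: eventually_ball_finite_distrib)
  then show ?thesis
    by (rule eventually_mono) (use S D(2) N(3) in blast)
qed

text \<open>
  Independence provides, for each 0-1 sequence \<open>\<sigma>\<close>, a nonempty compact set of points \<open>x\<close> with
  \<open>f i x \<in> P (\<sigma> i)\<close> for all \<open>i\<close>. A cluster point \<open>r\<close> of the sequence sends such a point into
  \<open>P j\<close> as soon as \<open>\<sigma>\<close> is eventually constant with value \<open>j\<close>, so the value of \<open>r\<close> depends on the
  tail of \<open>\<sigma>\<close>, whereas open conditions only see an initial segment of \<open>\<sigma>\<close>. To turn this into a
  failure of fragmentation one needs a closed set on which every nonempty relatively open piece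
  contains, for some initial segment, points for all its continuations. A minimal closed set
  meeting all the compact sets (on which the coding of points by sequences is irreducible) has
  this property.
\<close>

lemma independent_sequence_has_nonfragmented_cluster_point:
  fixes f :: "nat \<Rightarrow> 'a::topological_space \<Rightarrow> 'b::uniform_space"
  assumes cpt: "compact (UNIV :: 'a set)" "compact (UNIV :: 'b set)"
    and cont: "\<And>i. continuous_on UNIV (f i)"
    and P: "\<And>j :: bool. closed (P j)" "P True \<inter> P False = {}"
    and indep: "\<And>n \<sigma>. \<exists>x. \<forall>i<n. f i x \<in> P (\<sigma> i)"
  shows "\<exists>r\<in>closure (range f). \<not> fragmented r"
proof -
  define X where "X n \<sigma> = {x. \<forall>i<n. f i x \<in> P (\<sigma> i)}" for n :: nat and \<sigma>
  define Xi where "Xi \<sigma> = (\<Inter>n. X n \<sigma>)" for \<sigma>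
  have closedX: "closed (X n \<sigma>)" for n \<sigma>
  proof -
    have "X n \<sigma> = (\<Inter>i\<in>{..<n}. f i -` P (\<sigma> i))" unfolding X_def by auto
    moreover have "closed (f i -` P (\<sigma> i))" for i
      by (rule closed_vimage[OF P(1) cont])
    ultimately show ?thesis by auto
  qed
  have compactXi: "compact (Xi \<sigma>)" for \<sigma>
    unfolding Xi_def using closedX cpt(1) compact_Int_closed[OF cpt(1)] by (metis Int_UNIV_left closed_INT)
  have stage: "\<exists>n. X n \<sigma> \<subseteq> W" if W: "open W" "Xi \<sigma> \<subseteq> W" for \<sigma> W
  proof (rule ccontr)
    assume neg: "\<not> ?thesis"
    have "(- W) \<inter> (\<Inter>n\<in>UNIV. X n \<sigma>) \<noteq> {}"
    proof (rule compact_imp_fip_image)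
      show "compact (- W)" using compact_Int_closed[OF cpt(1), of "- W"] W(1) by auto
      show "closed (X n \<sigma>)" for n by (rule closedX)
      show "- W \<inter> (\<Inter>n\<in>I. X n \<sigma>) \<noteq> {}" if fin: "finite I" for I
      proof -
        obtain m where "\<forall>n\<in>I. n \<le> m" using fin unfolding finite_nat_set_iff_bounded_le by blast
        then have "X m \<sigma> \<subseteq> (\<Inter>n\<in>I. X n \<sigma>)" unfolding X_def by force
        then show ?thesis using neg by blast
      qed
    qed
    then show False using W(2) unfolding Xi_def by blast
  qed
  have nonempty: "Xi \<sigma> \<noteq> {}" for \<sigma>
  proof
    assume "Xi \<sigma> = {}"
    then obtain n where "X n \<sigma> \<subseteq> {}" using stage[of "{}" \<sigma>] by auto
    then show False using indep[of n \<sigma>] unfolding X_def by auto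
  qed
  \<comment> \<open>Complements of closed sets that meet every \<open>Xi \<sigma>\<close>; a maximal one is the complement of a
      minimal closed set of this kind.\<close>
  define \<W> where "\<W> = {W. open W \<and> (\<forall>\<sigma>. \<not> Xi \<sigma> \<subseteq> W)}"
  have "\<exists>W\<in>\<W>. \<forall>W'\<in>\<W>. W \<subseteq> W' \<longrightarrow> W' = W"
  proof (rule subset_Zorn_nonempty)
    show "\<W> \<noteq> {}" using nonempty unfolding \<W>_def by (auto intro!: exI[of _ "{}"])
    show "\<Union>\<C> \<in> \<W>" if \<C>: "\<C> \<noteq> {}" "subset.chain \<W> \<C>" for \<C>
    proof -
      have sub: "\<C> \<subseteq> \<W>" using \<C>(2) by (simp add: subset.chain_def)
      have "\<not> Xi \<sigma> \<subseteq> \<Union>\<C>" for \<sigma>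
      proof
        assume "Xi \<sigma> \<subseteq> \<Union>\<C>"
        then obtain \<D> where \<D>: "\<D> \<subseteq> \<C>" "finite \<D>" "Xi \<sigma> \<subseteq> \<Union>\<D>"
          using compactE[OF compactXi] sub unfolding \<W>_def by (metis (no_types, lifting) mem_Collect_eq subsetD)
        then have "\<D> \<noteq> {}" using nonempty by auto
        have "subset.chain \<W> \<D>"
          using \<C>(2) \<D>(1) sub unfolding subset.chain_def by blast
        from Union_in_chain[OF \<D>(2) \<open>\<D> \<noteq> {}\<close> this]
        show False using \<D> sub unfolding \<W>_def by blast
      qed
      then show ?thesis using sub unfolding \<W>_def by blast
    qed
  qed
  then obtain W where maximal: "W \<in> \<W>" "\<And>W'. W' \<in> \<W> \<Longrightarrow> W \<subseteq> W' \<Longrightarrow> W' = W"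
    by blast
  then have W: "open W" "\<And>\<sigma>. \<not> Xi \<sigma> \<subseteq> W"
    unfolding \<W>_def by auto
  have max: "\<exists>\<sigma>. Xi \<sigma> \<subseteq> W'" if "open W'" "W \<subset> W'" for W'
    using maximal(2)[of W'] that unfolding \<W>_def by blast
  obtain r where r: "inf (nhds r) (filtermap f sequentially) \<noteq> bot"
    using compact_UNIV_fun[OF cpt(2)] unfolding compact_filter
    by (metis UNIV_I always_eventually filtermap_bot_iff sequentially_bot)
  have cluster: "\<exists>i\<ge>m. f i \<in> N" if N: "open N" "r \<in> N" for N m
  proof (rule ccontr)
    assume "\<not> ?thesis"
    then have "eventually (\<lambda>q. q \<notin> N) (filtermap f sequentially)"
      unfolding eventually_filtermap eventually_sequentially by auto
    moreover have "eventually (\<lambda>q. q \<in> N) (nhds r)"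
      using N by (rule eventually_nhds_in_open)
    ultimately have "eventually (\<lambda>_. False) (inf (nhds r) (filtermap f sequentially))"
      unfolding eventually_inf by blast
    then show False using r by (simp add: trivial_limit_def)
  qed
  have "r \<in> closure (range f)"
    unfolding closure_iff_nhds_not_empty using cluster by blast
  moreover have tail: "r x \<in> P j" if x: "x \<in> Xi \<sigma>" and \<sigma>: "\<And>i. i \<ge> n \<Longrightarrow> \<sigma> i = j" for x \<sigma> n j
  proof (rule ccontr)
    assume neg: "r x \<notin> P j"
    have "open {p :: 'a \<Rightarrow> 'b. p x \<in> - P j}"
      by (intro open_coordinate_preimage open_Compl P)
    then obtain i where "i \<ge> n" "f i x \<notin> P j" using cluster[of _ n] neg by force
    moreover have "f i x \<in> P (\<sigma> i)" using x unfolding Xi_def X_def by blast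
    ultimately show False using \<sigma> by simp
  qed
  have "\<not> fragmented r"
  proof
    assume "fragmented r"
    moreover have "- W \<noteq> {}" using W(2) by auto
    moreover have "\<forall>\<^sub>F z in uniformity. z \<in> - (P True \<times> P False)"
      using disjoint_closed_sets_entourage[of "P True" "P False"] P
        compact_Int_closed[OF cpt(2), of "P True"] by simp
    ultimately obtain U where U: "U \<noteq> {}" "openin (top_of_set (- W)) U"
      "\<And>x y. x \<in> U \<Longrightarrow> y \<in> U \<Longrightarrow> (r x, r y) \<notin> P True \<times> P False"
      unfolding fragmented_def by (metis ComplD)
    then obtain V where V: "open V" "U = - W \<inter> V" by (auto simp: openin_open)
    have "W \<subset> W \<union> V" using U(1) V(2) by auto
    then obtain \<sigma> where "Xi \<sigma> \<subseteq> W \<union> V" using max W(1) V(1) by blast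
    then obtain n where n: "X n \<sigma> \<subseteq> W \<union> V" using stage W(1) V(1) by blast
    have "\<exists>x\<in>U. r x \<in> P j" for j
    proof -
      \<comment> \<open>Past stage \<open>n\<close> the sequence may be changed freely without leaving \<open>W \<union> V\<close>.\<close>
      define \<rho> where "\<rho> i = (if i < n then \<sigma> i else j)" for i
      have "Xi \<rho> \<subseteq> X n \<sigma>" unfolding Xi_def X_def \<rho>_def by auto
      then obtain x where "x \<in> Xi \<rho>" "x \<in> U" using W(2)[of \<rho>] n V(2) by blast
      then show ?thesis using tail[of x \<rho> n j] unfolding \<rho>_def by auto
    qed
    then show False using U(3) by blast
  qed
  ultimately show ?thesis by blast
qed


section \<open>Approximation in the tau-topology\<close>

lemma compact_flowD:
  fixes \<phi> :: "'g \<Rightarrow> 'x::t2_space \<Rightarrow> 'x"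
  assumes "compact_flow G \<phi>"
  shows "group G"
    and "g \<in> carrier G \<Longrightarrow> continuous_on UNIV (\<phi> g)"
    and "g \<in> carrier G \<Longrightarrow> h \<in> carrier G \<Longrightarrow> \<phi> (g \<otimes>\<^bsub>G\<^esub> h) = \<phi> g \<circ> \<phi> h"
    and "g \<in> carrier G \<Longrightarrow> \<phi> (inv\<^bsub>G\<^esub> g) (\<phi> g x) = x"
proof -
  interpret group_action G UNIV \<phi> using assms by (simp add: compact_flow_def)
  show "group G" by (rule group_hom.axioms(1)[OF group_hom])
  show "\<phi> (g \<otimes>\<^bsub>G\<^esub> h) = \<phi> g \<circ> \<phi> h" if "g \<in> carrier G" "h \<in> carrier G"
    using composition_rule[OF _ that] by auto
  show "\<phi> (inv\<^bsub>G\<^esub> g) (\<phi> g x) = x" if "g \<in> carrier G"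
    using orbit_sym_aux[OF that] by simp
  show "continuous_on UNIV (\<phi> g)" if "g \<in> carrier G"
    using assms that unfolding compact_flow_def
    by (auto dest!: homeomorphic_imp_continuous_map simp flip: continuous_map_iff_continuous2)
qed

text \<open>
  Membership \<open>a t \<in> circ G \<phi> u (D t)\<close> yields a group element near \<open>u\<close> moving an element of
  \<open>D t\<close> near \<open>a t\<close>, but a different one for each \<open>t\<close>. One group element serves finitely many
  targets because of \<open>u \<circ> d = d\<close>: an element \<open>g\<close> that serves the targets in \<open>T\<close> may be replaced by
  \<open>g \<otimes> h\<close> for every \<open>h\<close> close enough to \<open>u\<close>, since then \<open>\<phi> h \<circ> d\<close> is close to \<open>d\<close>, and \<open>h\<close> can
  be chosen to serve one more target. The neighbourhood \<open>N\<close> of \<open>u\<close> is part of the statement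
  for the sake of this induction.
\<close>

lemma simultaneous_circ_approximation:
  fixes \<phi> :: "'g \<Rightarrow> 'x::t2_space \<Rightarrow> 'x"
  assumes flow: "compact_flow G \<phi>"
    and u: "u \<in> closure (\<phi> ` carrier G)" "u \<circ> u = u"
    and "finite T"
    and "\<And>t. t \<in> T \<Longrightarrow> open (V t) \<and> a t \<in> V t \<and> u \<circ> a t = a t \<and>
           a t \<in> circ G \<phi> u (D t) \<and> (\<forall>d\<in>D t. u \<circ> d = d)"
    and "open N" "u \<in> N"
  shows "\<exists>g\<in>carrier G. \<phi> g \<in> N \<and> (\<forall>t\<in>T. \<exists>d\<in>D t. \<phi> g \<circ> d \<in> V t)"
  using assms(4-)
proof (induction T arbitrary: N rule: finite_induct)
  case empty
  then have "N \<inter> \<phi> ` carrier G \<noteq> {}"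
    using u(1) open_Int_closure_eq_empty[of N "\<phi> ` carrier G"] by blast
  then show ?case by blast
next
  case (insert t0 T)
  note right = continuous_comp_right
  have t0: "open (V t0)" "a t0 \<in> V t0" "u \<circ> a t0 = a t0" "a t0 \<in> circ G \<phi> u (D t0)"
    using insert.prems(1)[of t0] by blast+
  \<comment> \<open>The last two conditions make \<open>\<phi> g \<circ> \<phi> h\<close> lie in \<open>N\<close>, and bring \<open>\<phi> g \<circ> \<phi> h \<circ> d0\<close> into
      \<open>V t0\<close>, once \<open>\<phi> h\<close> is near \<open>u\<close> and \<open>\<phi> h \<circ> d0\<close> is near \<open>a t0\<close>.\<close>
  define N1 where "N1 = N \<inter> (\<lambda>p. p \<circ> u) -` N \<inter> (\<lambda>p. p \<circ> a t0) -` V t0"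
  have "open N1" unfolding N1_def
    using insert.prems(2) t0(1) by (intro open_Int open_vimage right)
  moreover have "u \<in> N1" unfolding N1_def using insert.prems(3) t0 u(2) by simp
  ultimately obtain g d where g: "g \<in> carrier G" "\<phi> g \<in> N1"
    and d: "\<And>t. t \<in> T \<Longrightarrow> d t \<in> D t \<and> \<phi> g \<circ> d t \<in> V t"
    using insert.IH insert.prems(1) by (metis insertI2)
  note left = continuous_comp_left[OF compact_flowD(2)[OF flow g(1)]]
  \<comment> \<open>How near to \<open>u\<close> and to \<open>a t0\<close> the new pair has to be.\<close>
  define N2 where "N2 = (\<lambda>p. \<phi> g \<circ> p) -` N \<inter> (\<Inter>t\<in>T. (\<lambda>p. \<phi> g \<circ> p \<circ> d t) -` V t)"
  define O2 where "O2 = (\<lambda>q. \<phi> g \<circ> q) -` V t0"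
  have "open ((\<lambda>p. \<phi> g \<circ> p \<circ> d t) -` V t)" if "t \<in> T" for t
    using insert.prems(1) that
    by (intro open_vimage continuous_on_compose2[OF right left]) auto
  then have "open N2" unfolding N2_def
    using insert.hyps(1) insert.prems(2) by (intro open_Int open_vimage left open_INT) auto
  moreover have "open O2" unfolding O2_def
    using t0(1) by (intro open_vimage left)
  ultimately have "open (N2 \<times> O2)" by (rule open_Times)
  moreover have "\<phi> g \<circ> u \<circ> d t = \<phi> g \<circ> d t" if "t \<in> T" for t
    using insert.prems(1) that d by (metis comp_assoc insertI2)
  then have "(u, a t0) \<in> N2 \<times> O2"
    using g(2) d unfolding N1_def N2_def O2_def by simp
  moreover have "(u, a t0) \<in> closure ((\<lambda>(g, a). (\<phi> g, \<phi> g \<circ> a)) ` (carrier G \<times> D t0))"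
    using t0(4) circ_iff_closure by blast
  ultimately have "(N2 \<times> O2) \<inter> (\<lambda>(g, a). (\<phi> g, \<phi> g \<circ> a)) ` (carrier G \<times> D t0) \<noteq> {}"
    using open_Int_closure_eq_empty by blast
  then obtain h d0 where h: "h \<in> carrier G" "d0 \<in> D t0" "\<phi> h \<in> N2" "\<phi> h \<circ> d0 \<in> O2"
    by auto
  interpret group G by (rule compact_flowD(1)[OF flow])
  have eq: "\<phi> (g \<otimes>\<^bsub>G\<^esub> h) = \<phi> g \<circ> \<phi> h" by (rule compact_flowD(3)[OF flow g(1) h(1)])
  have "\<phi> (g \<otimes>\<^bsub>G\<^esub> h) \<in> N" using h(3) unfolding eq N2_def by simp
  moreover have "\<exists>d\<in>D t. \<phi> (g \<otimes>\<^bsub>G\<^esub> h) \<circ> d \<in> V t" if "t \<in> insert t0 T" for t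
    using that h d unfolding eq N2_def O2_def by (auto simp: comp_assoc)
  ultimately show ?case using g(1) h(1) by blast
qed

lemma ellis_group_subset_ideal:
  assumes "minimal_left_ideal E M" "u \<in> M"
  shows "ellis_group u M \<subseteq> M"
  using assms unfolding ellis_group_def minimal_left_ideal_def left_ideal_def by blast

lemma comp_ellis_group:
  "u \<circ> u = u \<Longrightarrow> k \<in> ellis_group u M \<Longrightarrow> u \<circ> k = k"
  unfolding ellis_group_def by (auto simp flip: comp_assoc)

text \<open>
  If both sets were \<open>\<tau>\<close>-dense in \<open>A\<close>, the group would contain an independent sequence. The sequence
  consists of inverses of products \<open>w n = h 1 \<cdots> h n\<close>. At stage \<open>n\<close> each 0-1 word \<open>s\<close> of length
  \<open>n\<close> has a witness \<open>k s \<in> A\<close> such that the point \<open>w n (k s y)\<close> realizes the pattern \<open>s\<close> for the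
  inverses of \<open>w 1, \<dots>, w n\<close>. By density, a single \<open>h\<close> moves, for every \<open>s\<close> and every \<open>j\<close>, some
  \<open>k \<in> A\<close> with \<open>k y \<in> interior (P j)\<close> so close to \<open>k s\<close> that \<open>w n (h (k y))\<close> still realizes \<open>s\<close>.
  With \<open>w (n + 1) = w n h\<close>, the inverse of \<open>w (n + 1)\<close> takes this point back to \<open>k y\<close>, which
  realizes the next digit \<open>j\<close>. A cluster point of the resulting sequence lies in the enveloping
  semigroup and is not fragmented.
\<close>

lemma tame_not_doubly_tau_dense:
  fixes \<phi> :: "'g \<Rightarrow> 'x::{t2_space, uniform_space} \<Rightarrow> 'x"
  assumes tame: "tame_flow G \<phi>"
    and M: "minimal_left_ideal (enveloping_semigroup G \<phi>) M"
    and u: "u \<in> M" "u \<circ> u = u"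
    and A: "A \<noteq> {}" "A \<subseteq> ellis_group u M"
    and P: "\<And>j :: bool. closed (P j)" "P True \<inter> P False = {}"
  shows "\<exists>j. \<not> A \<subseteq> cl_tau G \<phi> u M {k \<in> A. k y \<in> interior (P j)}"
proof (rule ccontr)
  assume "\<not> ?thesis"
  then have both_dense: "k \<in> cl_tau G \<phi> u M {k \<in> A. k y \<in> interior (P j)}" if "k \<in> A" for k j
    using that by blast
  have flow: "compact_flow G \<phi>" using tame by (simp add: tame_flow_def)
  have uE: "u \<in> closure (\<phi> ` carrier G)"
    using M u unfolding minimal_left_ideal_def left_ideal_def enveloping_semigroup_def by blast
  interpret group G by (rule compact_flowD(1)[OF flow])
  note cont = compact_flowD(2)[OF flow]
  note mult = compact_flowD(3)[OF flow]
  have ucomp: "u \<circ> k = k" if "k \<in> A" for k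
    using comp_ellis_group[OF u(2)] A(2) that by blast
  \<comment> \<open>A state \<open>(w, C)\<close> at stage \<open>n\<close> holds the product \<open>w n\<close> and, for each word \<open>s\<close> of length
      \<open>n\<close>, the open set \<open>C s\<close> of points that realize the pattern \<open>s\<close>.\<close>
  define Good :: "nat \<Rightarrow> 'g \<times> (bool list \<Rightarrow> 'x set) \<Rightarrow> bool" where
    "Good n = (\<lambda>(w, C). w \<in> carrier G \<and>
       (\<forall>s. length s = n \<longrightarrow> open (C s) \<and> (\<exists>k\<in>A. \<phi> w (k y) \<in> C s)))" for n
  define Next :: "nat \<Rightarrow> 'g \<times> (bool list \<Rightarrow> 'x set) \<Rightarrow> 'g \<times> (bool list \<Rightarrow> 'x set) \<Rightarrow> bool" where
    "Next n = (\<lambda>(w, C) (w', C'). \<forall>s j. length s = n \<longrightarrow>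
       C' (s @ [j]) = C s \<inter> \<phi> (inv\<^bsub>G\<^esub> w') -` interior (P j))" for n
  have "\<exists>\<Sigma>. \<forall>n. Good n (\<Sigma> n) \<and> Next n (\<Sigma> n) (\<Sigma> (Suc n))"
  proof (rule dependent_nat_choice)
    show "\<exists>z. Good 0 z"
      using A(1) unfolding Good_def by (auto intro!: exI[of _ "\<one>\<^bsub>G\<^esub>"] exI[of _ "\<lambda>_. UNIV"])
  next
    fix z n assume "Good n z"
    then obtain w C where z: "z = (w, C)" and w: "w \<in> carrier G"
      and openC: "\<And>s. length s = n \<Longrightarrow> open (C s)"
      and "\<And>s. length s = n \<Longrightarrow> \<exists>k\<in>A. \<phi> w (k y) \<in> C s"
      unfolding Good_def by (cases z) auto
    then obtain a where a: "\<And>s. length s = n \<Longrightarrow> a s \<in> A \<and> \<phi> w (a s y) \<in> C s"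
      by metis
    define T where "T = {s :: bool list. length s = n} \<times> (UNIV :: bool set)"
    have "finite T" unfolding T_def
      using finite_lists_length_eq[of "UNIV :: bool set" n] by simp
    have openV: "open {p. \<phi> w (p y) \<in> C s}" if "length s = n" for s
    proof -
      have "continuous_on UNIV (\<lambda>p :: 'x \<Rightarrow> 'x. \<phi> w (p y))"
        by (intro continuous_on_compose2[OF cont[OF w]] continuous_on_product_coordinates) auto
      from open_vimage[OF openC[OF that] this] show ?thesis by (simp add: vimage_def)
    qed
    have "\<exists>h\<in>carrier G. \<phi> h \<in> UNIV \<and> (\<forall>t\<in>T. \<exists>d\<in>{k \<in> A. k y \<in> interior (P (snd t))}.
        \<phi> h \<circ> d \<in> {p. \<phi> w (p y) \<in> C (fst t)})"
    proof (rule simultaneous_circ_approximation[OF flow uE u(2) \<open>finite T\<close>,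
          where a = "\<lambda>t. a (fst t)"])
      fix t assume "t \<in> T"
      then have len: "length (fst t) = n" unfolding T_def by auto
      show "open {p. \<phi> w (p y) \<in> C (fst t)} \<and> a (fst t) \<in> {p. \<phi> w (p y) \<in> C (fst t)} \<and>
        u \<circ> a (fst t) = a (fst t) \<and>
        a (fst t) \<in> circ G \<phi> u {k \<in> A. k y \<in> interior (P (snd t))} \<and>
        (\<forall>d\<in>{k \<in> A. k y \<in> interior (P (snd t))}. u \<circ> d = d)"
        using openV[OF len] a[OF len] ucomp both_dense[of "a (fst t)" "snd t"]
        unfolding cl_tau_def by auto
    qed auto
    then obtain h where h: "h \<in> carrier G"
      and hd: "\<And>s j. length s = n \<Longrightarrow> \<exists>k\<in>A. k y \<in> interior (P j) \<and> \<phi> w (\<phi> h (k y)) \<in> C s"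
      unfolding T_def by (force simp: Ball_def)
    define w' where "w' = w \<otimes>\<^bsub>G\<^esub> h"
    define C' where "C' s = C (butlast s) \<inter> \<phi> (inv\<^bsub>G\<^esub> w') -` interior (P (last s))" for s
    have w': "w' \<in> carrier G" unfolding w'_def using w h by simp
    have "open (C' s) \<and> (\<exists>k\<in>A. \<phi> w' (k y) \<in> C' s)" if s: "length s = Suc n" for s
    proof
      have len: "length (butlast s) = n" using s by simp
      show "open (C' s)" unfolding C'_def
        using w' by (intro open_Int openC[OF len] open_vimage cont) auto
      obtain k where "k \<in> A" "k y \<in> interior (P (last s))" "\<phi> w (\<phi> h (k y)) \<in> C (butlast s)"
        using hd[OF len] by blast
      then show "\<exists>k\<in>A. \<phi> w' (k y) \<in> C' s"
        unfolding C'_def using compact_flowD(4)[OF flow w'] mult[OF w h]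
        by (intro bexI[of _ k]) (auto simp: w'_def)
    qed
    then have "Good (Suc n) (w', C')" unfolding Good_def using w' by simp
    moreover have "Next n z (w', C')" unfolding Next_def z C'_def by simp
    ultimately show "\<exists>z'. Good (Suc n) z' \<and> Next n z z'" by blast
  qed
  then obtain \<Sigma> where \<Sigma>: "\<And>n. Good n (\<Sigma> n)" "\<And>n. Next n (\<Sigma> n) (\<Sigma> (Suc n))" by blast
  define f where "f i = \<phi> (inv\<^bsub>G\<^esub> (fst (\<Sigma> (Suc i))))" for i
  have fG: "inv\<^bsub>G\<^esub> (fst (\<Sigma> n)) \<in> carrier G" for n
    using \<Sigma>(1)[of n] unfolding Good_def by (auto simp: case_prod_unfold)
  have cells: "\<forall>i<n. f i x \<in> P (\<sigma> i)" if "x \<in> snd (\<Sigma> n) (map \<sigma> [0..<n])" for n x \<sigma>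
    using that
  proof (induction n)
    case (Suc n)
    have "snd (\<Sigma> (Suc n)) (map \<sigma> [0..<n] @ [\<sigma> n]) =
        snd (\<Sigma> n) (map \<sigma> [0..<n]) \<inter> f n -` interior (P (\<sigma> n))"
      using \<Sigma>(2)[of n] unfolding Next_def f_def by (simp add: case_prod_unfold)
    then show ?case using Suc interior_subset by (fastforce simp: less_Suc_eq)
  qed simp
  have "\<exists>x. \<forall>i<n. f i x \<in> P (\<sigma> i)" for n \<sigma>
  proof -
    have "length (map \<sigma> [0..<n]) = n" by simp
    then obtain k where "\<phi> (fst (\<Sigma> n)) (k y) \<in> snd (\<Sigma> n) (map \<sigma> [0..<n])"
      using \<Sigma>(1)[of n] unfolding Good_def case_prod_unfold by blast
    then show ?thesis using cells by blast
  qed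
  moreover have "compact (UNIV :: 'x set)" using flow by (simp add: compact_flow_def)
  moreover have "continuous_on UNIV (f i)" for i unfolding f_def by (rule cont[OF fG])
  ultimately obtain r where r: "r \<in> closure (range f)" "\<not> fragmented r"
    using independent_sequence_has_nonfragmented_cluster_point[of f P] P by blast
  have "range f \<subseteq> \<phi> ` carrier G" unfolding f_def using fG by auto
  then have "r \<in> enveloping_semigroup G \<phi>"
    using r(1) closure_mono unfolding enveloping_semigroup_def by blast
  then show False using r(2) tame unfolding tame_flow_def by blast
qed


section \<open>Measurability\<close>

text \<open>
  It is enough to find, for \<open>a < b\<close>, a measurable set between \<open>{x. b \<le> h x}\<close> and
  \<open>{x. a < h x}\<close>. Call an open set good if this can be done inside it. Countable unions of good
  sets are good, and compact inner regularity shows that the union of all good sets differs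
  by a null set from a countable union of them; completeness absorbs the null set, so there
  is a largest good set. The separation hypothesis, applied to its complement, would enlarge
  it unless it is the whole space.
\<close>

lemma level_separated_imp_completion_measurable:
  fixes h :: "'a \<Rightarrow> real"
  assumes space: "space \<mu> = topspace T"
    and open_sets: "\<And>U. openin T U \<Longrightarrow> U \<in> sets \<mu>"
    and fin: "emeasure \<mu> (topspace T) \<noteq> \<infinity>"
    and inner: "\<And>U. openin T U \<Longrightarrow>
       emeasure \<mu> U = (SUP C\<in>{C. compactin T C \<and> C \<subseteq> U}. emeasure \<mu> C)"
    and frag: "\<And>A a b. closedin T A \<Longrightarrow> A \<noteq> {} \<Longrightarrow> a < b \<Longrightarrow>
       \<exists>U. openin T U \<and> U \<inter> A \<noteq> {} \<and> ((\<forall>x\<in>U \<inter> A. h x < b) \<or> (\<forall>x\<in>U \<inter> A. a < h x))"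
  shows "h \<in> borel_measurable (completion \<mu>)"
proof -
  let ?S = "sets (completion \<mu>)"
  have sandwich: "\<exists>B\<in>?S. topspace T \<inter> {x. b \<le> h x} \<subseteq> B \<and> B \<subseteq> topspace T \<inter> {x. a < h x}"
    if ab: "a < b" for a b
  proof -
    define good where "good W \<longleftrightarrow> openin T W \<and>
      (\<exists>B\<in>?S. W \<inter> {x. b \<le> h x} \<subseteq> B \<and> B \<subseteq> topspace T \<inter> {x. a < h x})" for W
    have countable_Union: "good (\<Union>\<V>)" if \<V>: "countable \<V>" "\<And>V. V \<in> \<V> \<Longrightarrow> good V" for \<V>
    proof -
      obtain B where B: "\<And>V. V \<in> \<V> \<Longrightarrow> B V \<in> ?S \<and> V \<inter> {x. b \<le> h x} \<subseteq> B V \<and>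
          B V \<subseteq> topspace T \<inter> {x. a < h x}"
        using \<V>(2) unfolding good_def by metis
      then have "(\<Union>V\<in>\<V>. B V) \<in> ?S" using \<V>(1) by (intro sets.countable_UN') auto
      moreover have "\<Union>\<V> \<inter> {x. b \<le> h x} \<subseteq> (\<Union>V\<in>\<V>. B V)"
        "(\<Union>V\<in>\<V>. B V) \<subseteq> topspace T \<inter> {x. a < h x}" using B by blast+
      moreover have "openin T (\<Union>\<V>)" using \<V>(2) unfolding good_def by blast
      ultimately show ?thesis unfolding good_def by blast
    qed
    define W where "W = \<Union>{V. good V}"
    have openW: "openin T W" unfolding W_def good_def by blast
    have goodW: "good W"
    proof -
      have "(\<lambda>C. emeasure \<mu> C) ` {C. compactin T C \<and> C \<subseteq> W} \<noteq> {}" by auto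
      from ennreal_Sup_countable_SUP[OF this] obtain m :: "nat \<Rightarrow> ennreal"
        where m: "range m \<subseteq> emeasure \<mu> ` {C. compactin T C \<and> C \<subseteq> W}"
          "emeasure \<mu> W = (SUP i. m i)"
        using inner[OF openW] by auto
      then have "\<forall>i. \<exists>C. compactin T C \<and> C \<subseteq> W \<and> m i = emeasure \<mu> C"
        by (auto simp: image_subset_iff) 
      then obtain C where C: "\<And>i. compactin T (C i)" "\<And>i. C i \<subseteq> W" "\<And>i. m i = emeasure \<mu> (C i)"
        by metis
      have "\<exists>\<V>. finite \<V> \<and> \<V> \<subseteq> {V. good V} \<and> C i \<subseteq> \<Union>\<V>" for i
        using compactinD[OF C(1)[of i], of "{V. good V}"] C(2)[of i]
        unfolding W_def good_def by auto
      then obtain \<V> where \<V>: "\<And>i. finite (\<V> i)" "\<And>i. \<V> i \<subseteq> {V. good V}" "\<And>i. C i \<subseteq> \<Union>(\<V> i)"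
        by metis
      define W' where "W' = \<Union>(\<Union>i. \<V> i)"
      have "good W'" unfolding W'_def
        using \<V> by (intro countable_Union) (auto simp: countable_finite)
      then have W': "openin T W'" "W' \<subseteq> W" unfolding W_def good_def by auto
      obtain B where B: "B \<in> ?S" "W' \<inter> {x. b \<le> h x} \<subseteq> B" "B \<subseteq> topspace T \<inter> {x. a < h x}"
        using \<open>good W'\<close> unfolding good_def by blast
      have "emeasure \<mu> W \<le> emeasure \<mu> W'" unfolding m(2)
      proof (rule SUP_least)
        fix i
        have "C i \<subseteq> W'" using \<V>(3)[of i] unfolding W'_def by blast
        then show "m i \<le> emeasure \<mu> W'" unfolding C(3)
          using emeasure_mono open_sets[OF W'(1)] by blast
      qed
      then have "emeasure \<mu> W' = emeasure \<mu> W"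
        using emeasure_mono[OF W'(2) open_sets[OF openW]] by (rule antisym[rotated])
      moreover have "emeasure \<mu> W' \<noteq> \<infinity>"
        using fin emeasure_mono[of W' "topspace T" \<mu>] open_sets openin_subset[OF W'(1)]
        by (metis infinity_ennreal_def neq_top_trans openin_topspace)
      ultimately have "emeasure \<mu> (W - W') = 0"
        using emeasure_Diff[of \<mu> W' W] W'(2) open_sets[OF W'(1)] open_sets[OF openW] by simp
      then have "W - W' \<in> null_sets \<mu>"
        using open_sets[OF W'(1)] open_sets[OF openW] by auto
      then have "(W - W') \<inter> {x. a < h x} \<in> ?S"
        by (intro sets_completionI_sub[of "W - W'"]) auto
      with B(1) have "B \<union> (W - W') \<inter> {x. a < h x} \<in> ?S" by (rule sets.Un)
      moreover have "W \<inter> {x. b \<le> h x} \<subseteq> B \<union> (W - W') \<inter> {x. a < h x}" using B(2) ab by auto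
      moreover have "B \<union> (W - W') \<inter> {x. a < h x} \<subseteq> topspace T \<inter> {x. a < h x}"
        using B(3) openin_subset[OF openW] by auto
      ultimately show ?thesis using openW unfolding good_def by blast
    qed
    have "W = topspace T"
    proof (rule ccontr)
      assume "W \<noteq> topspace T"
      then have "topspace T - W \<noteq> {}" using openin_subset[OF openW] by auto
      moreover have "closedin T (topspace T - W)" using openW by (rule openin_closedin_eq[THEN iffD1, THEN conjunct2])
      ultimately obtain U where U: "openin T U" "U \<inter> (topspace T - W) \<noteq> {}"
        "(\<forall>x\<in>U \<inter> (topspace T - W). h x < b) \<or> (\<forall>x\<in>U \<inter> (topspace T - W). a < h x)"
        using frag[OF _ _ ab] by blast
      obtain B where B: "B \<in> ?S" "W \<inter> {x. b \<le> h x} \<subseteq> B" "B \<subseteq> topspace T \<inter> {x. a < h x}"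
        using goodW unfolding good_def by blast
      have UT: "U \<subseteq> topspace T" by (rule openin_subset[OF U(1)])
      have "good (W \<union> U)"
        using U(3)
      proof
        assume *: "\<forall>x\<in>U \<inter> (topspace T - W). h x < b"
        then have "(W \<union> U) \<inter> {x. b \<le> h x} \<subseteq> B" using B(2) UT by force
        then show ?thesis using B U(1) openW unfolding good_def by blast
      next
        assume *: "\<forall>x\<in>U \<inter> (topspace T - W). a < h x"
        have "B \<union> (U - W) \<in> ?S"
          using B(1) open_sets[OF U(1)] open_sets[OF openW] by auto
        moreover have "(W \<union> U) \<inter> {x. b \<le> h x} \<subseteq> B \<union> (U - W)" using B(2) by auto
        moreover have "B \<union> (U - W) \<subseteq> topspace T \<inter> {x. a < h x}" using B(3) * UT by auto
        ultimately show ?thesis using U(1) openW unfolding good_def by blast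
      qed
      then have "U \<subseteq> W" unfolding W_def by blast
      then show False using U(2) by blast
    qed
    then show ?thesis using goodW unfolding good_def by blast
  qed
  show ?thesis unfolding borel_measurable_iff_greater
  proof
    fix a
    have "\<forall>n. \<exists>B\<in>?S. topspace T \<inter> {x. a + 1 / real (Suc n) \<le> h x} \<subseteq> B \<and> B \<subseteq> topspace T \<inter> {x. a < h x}"
      by (intro allI sandwich) simp
    then obtain B where B: "\<And>n. B n \<in> ?S"
      "\<And>n. topspace T \<inter> {x. a + 1 / real (Suc n) \<le> h x} \<subseteq> B n"
      "\<And>n. B n \<subseteq> topspace T \<inter> {x. a < h x}"
      by metis
    have "{x \<in> space (completion \<mu>). a < h x} = (\<Union>n. B n)"
    proof
      show "{x \<in> space (completion \<mu>). a < h x} \<subseteq> (\<Union>n. B n)"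
      proof
        fix x assume x: "x \<in> {x \<in> space (completion \<mu>). a < h x}"
        then obtain n where "1 / real (Suc n) < h x - a"
          using nat_approx_posE[of "h x - a"] by (metis diff_gt_0_iff_gt mem_Collect_eq)
        then show "x \<in> (\<Union>n. B n)" using B(2)[of n] x space by auto
      qed
      show "(\<Union>n. B n) \<subseteq> {x \<in> space (completion \<mu>). a < h x}" using B(3) space by auto
    qed
    then show "{x \<in> space (completion \<mu>). a < h x} \<in> ?S" using B(1) by auto
  qed
qed

text \<open>
  Of the two sets \<open>{k \<in> A. f (k y) < c}\<close> and \<open>{k \<in> A. d < f (k y)}\<close>, with \<open>a < c < d < b\<close>, one is not
  \<open>\<tau>\<close>-dense in \<open>A\<close>; on the part of \<open>A\<close> outside its \<open>\<tau>\<close>-closure \<open>f (k y) \<ge> c > a\<close> or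
  \<open>f (k y) \<le> d < b\<close>.
\<close>

lemma tame_coordinate_measurable:
  fixes \<phi> :: "'g \<Rightarrow> 'x::{t2_space, uniform_space} \<Rightarrow> 'x" and f :: "'x \<Rightarrow> real"
  assumes tame: "tame_flow G \<phi>"
    and M: "minimal_left_ideal (enveloping_semigroup G \<phi>) M"
    and u: "u \<in> M" "u \<circ> u = u"
    and \<mu>: "normalized_haar_measure (tau_topology G \<phi> u M) (\<circ>) \<mu>"
    and f: "continuous_on UNIV f"
  shows "(\<lambda>k. f (k y)) \<in> borel_measurable (completion \<mu>)"
proof -
  let ?T = "tau_topology G \<phi> u M" and ?K = "ellis_group u M"
  have flow: "compact_flow G \<phi>" using tame by (simp add: tame_flow_def)
  note top = topspace_tau_topology[OF flow M u]
  show ?thesis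
  proof (rule level_separated_imp_completion_measurable)
    show "space \<mu> = topspace ?T" "emeasure \<mu> (topspace ?T) \<noteq> \<infinity>"
      using \<mu> unfolding normalized_haar_measure_def by auto
    show "U \<in> sets \<mu>" if "openin ?T U" for U
      using \<mu> that unfolding normalized_haar_measure_def by auto
    show "emeasure \<mu> U = (SUP C\<in>{C. compactin ?T C \<and> C \<subseteq> U}. emeasure \<mu> C)" if "openin ?T U" for U
      using \<mu> that unfolding normalized_haar_measure_def by blast
  next
    fix A and a b :: real
    assume A: "closedin ?T A" "A \<noteq> {}" and "a < b"
    then obtain c d where cd: "a < c" "c < d" "d < b" by (meson dense)
    define P where "P j = (if j then {x. f x \<le> c} else {x. d \<le> f x})" for j
    have AK: "A \<subseteq> ?K" using closedin_subset[OF A(1)] top by simp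
    have "closed (P j)" for j
      unfolding P_def by (auto intro!: closed_Collect_le continuous_on_const f)
    moreover have "P True \<inter> P False = {}" unfolding P_def using cd by auto
    ultimately obtain j where j: "\<not> A \<subseteq> cl_tau G \<phi> u M {k \<in> A. k y \<in> interior (P j)}"
      using tame_not_doubly_tau_dense[OF tame M u A(2) AK, of P y] by auto
    let ?D = "{k \<in> A. k y \<in> interior (P j)}"
    have DK: "?D \<subseteq> ?K" using AK by auto
    define U where "U = ?K - cl_tau G \<phi> u M ?D"
    have "closedin ?T (cl_tau G \<phi> u M ?D)"
      using closedin_closure_of[of ?T ?D] closure_of_tau_topology[OF flow M u DK] by simp
    from openin_diff[OF openin_topspace this] have "openin ?T U"
      unfolding U_def top .
    moreover have "U \<inter> A \<noteq> {}" using j AK unfolding U_def by blast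
    moreover have outside: "k y \<notin> interior (P j)" if "k \<in> U \<inter> A" for k
      using that cl_tau_extensive[OF flow M u DK] unfolding U_def by blast
    have "(\<forall>k\<in>U \<inter> A. f (k y) < b) \<or> (\<forall>k\<in>U \<inter> A. a < f (k y))"
    proof (cases j)
      case True
      have "{x. f x < c} \<subseteq> interior (P j)"
        unfolding P_def using True by (intro interior_maximal) (auto intro!: open_Collect_less f continuous_on_const)
      then show ?thesis using outside cd(1) by force
    next
      case False
      have "{x. d < f x} \<subseteq> interior (P j)"
        unfolding P_def using False by (intro interior_maximal) (auto intro!: open_Collect_less f continuous_on_const)
      then show ?thesis using outside cd(3) by force
    qed
    ultimately show "\<exists>U. openin ?T U \<and> U \<inter> A \<noteq> {} \<and>
        ((\<forall>k\<in>U \<inter> A. f (k y) < b) \<or> (\<forall>k\<in>U \<inter> A. a < f (k y)))"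
      by blast
  qed
qed

text \<open>
  The continuous functions on \<open>E\<close> that are measurable form an algebra, closed under uniform limits
  and containing the functions \<open>p \<mapsto> f (p y)\<close>, which separate points.
\<close>

lemma measurable_by_coordinates:
  fixes E :: "('x \<Rightarrow> 'x::t2_space) set" and F :: "('x \<Rightarrow> 'x) \<Rightarrow> real"
  assumes X: "compact (UNIV :: 'x set)" and E: "closed E" and N: "space N \<subseteq> E"
    and coord: "\<And>f y. continuous_on UNIV (f :: 'x \<Rightarrow> real) \<Longrightarrow> (\<lambda>p. f (p y)) \<in> borel_measurable N"
    and F: "continuous_on E F"
  shows "F \<in> borel_measurable N"
proof -
  define R where "R = {F :: ('x \<Rightarrow> 'x) \<Rightarrow> real. continuous_on E F \<and> F \<in> borel_measurable N}"
  interpret function_ring_on R E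
  proof
    show "compact E" using compact_Int_closed[OF compact_UNIV_fun[OF X] E] by simp
    show "\<exists>f\<in>R. f p \<noteq> f q"
      if pq: "p \<noteq> q" for p q :: "'x \<Rightarrow> 'x"
    proof -
      obtain y where "p y \<noteq> q y" using pq by auto
      then obtain f :: "'x \<Rightarrow> real" where f: "continuous_on UNIV f" "f (p y) \<noteq> f (q y)"
        using compact_Hausdorff_separating_function[OF X] by blast
      have "continuous_on E (\<lambda>p. f (p y))"
        by (rule continuous_on_compose2[OF f(1)])
          (auto intro: continuous_on_subset[OF continuous_on_product_coordinates])
      with coord[OF f(1), of y] have "(\<lambda>p. f (p y)) \<in> R"
        unfolding R_def by simp
      then show ?thesis by (rule rev_bexI) (rule f(2))
    qed
  qed (auto simp: R_def intro: continuous_intros)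
  obtain g where g: "\<And>n. g n \<in> R"
    and lim: "uniform_limit E g F sequentially"
    using Stone_Weierstrass[OF F] by auto
  show ?thesis
  proof (rule borel_measurable_LIMSEQ_real)
    show "g n \<in> borel_measurable N" for n using g unfolding R_def by blast
    show "(\<lambda>n. g n p) \<longlonglongrightarrow> F p" if "p \<in> space N" for p
      using tendsto_uniform_limitI[OF lim] N that by blast
  qed
qed

theorem corollary3p5:
  fixes G :: "('g, 'b) monoid_scheme"
    and \<phi> :: "'g \<Rightarrow> 'x::{t2_space, uniform_space} \<Rightarrow> 'x"
    and M K :: "('x \<Rightarrow> 'x) set"
    and u :: "'x \<Rightarrow> 'x"
    and j :: "('x \<Rightarrow> 'x) \<Rightarrow> ('x \<Rightarrow> 'x)"
    and \<mu> :: "('x \<Rightarrow> 'x) measure"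
    and F :: "('x \<Rightarrow> 'x) \<Rightarrow> complex"
  assumes "tame_flow G \<phi>"
    and "minimal_left_ideal (enveloping_semigroup G \<phi>) M"
    and "u \<in> M" and "u \<circ> u = u"
    and "K = ellis_group u M"
    and "\<And>k. k \<in> K \<Longrightarrow> j k = k"
    and "normalized_haar_measure (tau_topology G \<phi> u M) (\<circ>) \<mu>"
    and "continuous_on (enveloping_semigroup G \<phi>) F"
  shows "F \<circ> j \<in> borel_measurable (completion \<mu>)"
proof -
  let ?E = "enveloping_semigroup G \<phi>"
  have flow: "compact_flow G \<phi>" using assms(1) by (simp add: tame_flow_def)
  have sp: "space (completion \<mu>) = K"
    using assms(7) topspace_tau_topology[OF flow assms(2-4)] assms(5)
    unfolding normalized_haar_measure_def by simp
  have "K \<subseteq> ?E"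
    using ellis_group_subset_ideal[OF assms(2,3)] assms(2,5)
    unfolding minimal_left_ideal_def left_ideal_def by blast
  have meas: "H \<in> borel_measurable (completion \<mu>)" if "continuous_on ?E H" for H :: "_ \<Rightarrow> real"
  proof (rule measurable_by_coordinates)
    show "compact (UNIV :: 'x set)" using flow by (simp add: compact_flow_def)
    show "closed ?E" by (simp add: enveloping_semigroup_def)
    show "space (completion \<mu>) \<subseteq> ?E" using sp \<open>K \<subseteq> ?E\<close> by simp
    show "(\<lambda>p. f (p y)) \<in> borel_measurable (completion \<mu>)"
      if "continuous_on UNIV f" for f :: "'x \<Rightarrow> real" and y
      by (rule tame_coordinate_measurable[OF assms(1-4,7) that])
  qed (rule that)
  have "F \<in> borel_measurable (completion \<mu>)"
    unfolding borel_measurable_complex_iff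
    using assms(8) by (auto intro!: meas continuous_intros)
  then show ?thesis
    by (rule measurable_cong[THEN iffD1, rotated]) (use sp assms(6) in auto)
qed

end
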